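(* Let $d\ge 1$ be an integer and let $1\leq p<q<\infty$. Let $m^p_q=m^p_q(\mathbb{R}^d)$ be the small Morrey space. Then its von Neumann--Jordan constant, James constant and Dunkl--Williams constant satisfy $C_{\rm NJ}(m^p_q)=C_{\rm J}(m^p_q)=2$ and $C_{\rm DW}(m^p_q)=4$.
   Context: For $a\in\mathbb{R}^d$ and $R>0$, $B(a,R)$ is the open ball in $\mathbb{R}^d$ with center $a$ and radius $R$, and $|B(a,R)|$ is its Lebesgue measure. For $1\le p\le q<\infty$, the small Morrey space $m^p_q=m^p_q(\mathbb{R}^d)$ is the set of all measurable (real- or complex-valued) functions $f$ on $\mathbb{R}^d$, identified when equal almost everywhere, such that $$\|f\|_{m^p_q} := \sup_{a\in \mathbb{R}^d,\ R\in(0,1)}|B(a,R)|^{\frac{1}{q}-\frac{1}{p}}\biggl(\int_{B(a,R)} |f(y)|^p\, dy\biggr)^{\frac{1}{p}}<\infty.$$ It is a Banach space with this norm. For a Banach space $(X,\|\cdot\|_X)$, the three constants are defined by $$C_{\rm NJ}(X) := \sup\biggl\{\frac{\|x+y\|_X^2+\|x-y\|_X^2}{2(\|x\|_X^2+\|y\|_X^2)} : x,y \in X\setminus \{0\} \biggr\},$$ $$C_{\rm J}(X) := \sup\bigl\{\min\{\|x+y\|_X,\|x-y\|_X\} : x,y\in X,\ \|x\|_X=\|y\|_X=1 \bigr\},$$ $$C_{\rm DW}(X) := \sup\biggl\{\frac{\|x\|_X+\|y\|_X}{\|x-y\|_X}\biggl\|\frac{x}{\|x\|_X}-\frac{y}{\|y\|_X}\biggr\|_X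 : x,y \in X\setminus \{0\},\ x\neq y \biggr\}.$$ *)

theory Defs
  imports "HOL-Analysis.Analysis"
begin

section \<open>Measurable functions modulo equality almost everywhere\<close>

quotient_type (overloaded) ('a, 'b) ae_fun =
  "'a::euclidean_space \<Rightarrow> 'b::{real_normed_vector, second_countable_topology}" / partial:
  "\<lambda>f g. f \<in> borel_measurable lebesgue \<and> g \<in> borel_measurable lebesgue
         \<and> (AE x in lebesgue. f x = g x)"
proof (rule part_equivpI)
  show "\<exists>f::'a \<Rightarrow> 'b. f \<in> borel_measurable lebesgue \<and> f \<in> borel_measurable lebesgue
         \<and> (AE x in lebesgue. f x = f x)"
    by (intro exI[of _ "\<lambda>_. 0"]) simp
  show "symp (\<lambda>f g::'a \<Rightarrow> 'b. f \<in> borel_measurable lebesgue \<and> g \<in> borel_measurable lebesgue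
         \<and> (AE x in lebesgue. f x = g x))"
    by (auto simp: symp_def elim: AE_mp)
  show "transp (\<lambda>f g::'a \<Rightarrow> 'b. f \<in> borel_measurable lebesgue \<and> g \<in> borel_measurable lebesgue
         \<and> (AE x in lebesgue. f x = g x))"
    unfolding transp_def
  proof (intro allI impI, elim conjE, intro conjI)
    fix f g h :: "'a \<Rightarrow> 'b"
    assume "AE x in lebesgue. f x = g x" "AE x in lebesgue. g x = h x"
    then show "AE x in lebesgue. f x = h x"
      by eventually_elim simp
  qed
qed

instantiation ae_fun ::
  (euclidean_space, "{real_normed_vector, second_countable_topology}") real_vector
begin

lift_definition zero_ae_fun :: "('a, 'b) ae_fun" is "\<lambda>_. 0"
  by simp

lift_definition plus_ae_fun :: "('a, 'b) ae_fun \<Rightarrow> ('a, 'b) ae_fun \<Rightarrow> ('a, 'b) ae_fun"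
  is "\<lambda>f g x. f x + g x"
  by auto

lift_definition minus_ae_fun :: "('a, 'b) ae_fun \<Rightarrow> ('a, 'b) ae_fun \<Rightarrow> ('a, 'b) ae_fun"
  is "\<lambda>f g x. f x - g x"
  by auto

lift_definition uminus_ae_fun :: "('a, 'b) ae_fun \<Rightarrow> ('a, 'b) ae_fun"
  is "\<lambda>f x. - f x"
  by auto

lift_definition scaleR_ae_fun :: "real \<Rightarrow> ('a, 'b) ae_fun \<Rightarrow> ('a, 'b) ae_fun"
  is "\<lambda>c f x. c *\<^sub>R f x"
  by auto

instance
  by standard (transfer; auto simp: algebra_simps)+

end


section \<open>Small Morrey spaces\<close>

text \<open>For exponents \<open>s > 0\<close>: an infinite integral must give an infinite norm, whereas
  \<^const>\<open>enn2real\<close> sends \<open>\<infinity>\<close> to \<open>0\<close>.\<close>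

definition ennreal_powr :: "ennreal \<Rightarrow> real \<Rightarrow> ennreal" where
  "ennreal_powr t s = (if t = \<infinity> then \<infinity> else ennreal (enn2real t powr s))"

lift_definition small_morrey_enorm :: "real \<Rightarrow> real \<Rightarrow>
    ('a::euclidean_space, 'b::{real_normed_vector, second_countable_topology}) ae_fun \<Rightarrow> ennreal"
  is "\<lambda>p q f. SUP (a, R) \<in> UNIV \<times> {0<..<1}.
        ennreal (measure lebesgue (ball a R) powr (1 / q - 1 / p)) *
        ennreal_powr (\<integral>\<^sup>+ y \<in> ball a R. ennreal (norm (f y) powr p) \<partial>lebesgue) (1 / p)"
proof -
  fix p q :: real and f g :: "'a \<Rightarrow> 'b"
  assume "f \<in> borel_measurable lebesgue \<and> g \<in> borel_measurable lebesgue
          \<and> (AE x in lebesgue. f x = g x)"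
  then have ae: "AE x in lebesgue. f x = g x"
    by simp
  have "(\<integral>\<^sup>+ y \<in> ball a R. ennreal (norm (f y) powr p) \<partial>lebesgue) =
        (\<integral>\<^sup>+ y \<in> ball a R. ennreal (norm (g y) powr p) \<partial>lebesgue)" for a R
    using ae by (intro nn_integral_cong_AE) (auto elim!: eventually_mono)
  then show "(SUP (a, R) \<in> UNIV \<times> {0<..<1}.
        ennreal (measure lebesgue (ball a R) powr (1 / q - 1 / p)) *
        ennreal_powr (\<integral>\<^sup>+ y \<in> ball a R. ennreal (norm (f y) powr p) \<partial>lebesgue) (1 / p)) =
      (SUP (a, R) \<in> UNIV \<times> {0<..<1}.
        ennreal (measure lebesgue (ball a R) powr (1 / q - 1 / p)) *
        ennreal_powr (\<integral>\<^sup>+ y \<in> ball a R. ennreal (norm (g y) powr p) \<partial>lebesgue) (1 / p))"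
    by simp
qed

definition small_morrey :: "real \<Rightarrow> real \<Rightarrow>
    ('a::euclidean_space, 'b::{real_normed_vector, second_countable_topology}) ae_fun set" where
  "small_morrey p q = {f. small_morrey_enorm p q f < \<infinity>}"

definition small_morrey_norm :: "real \<Rightarrow> real \<Rightarrow>
    ('a::euclidean_space, 'b::{real_normed_vector, second_countable_topology}) ae_fun \<Rightarrow> real" where
  "small_morrey_norm p q f = enn2real (small_morrey_enorm p q f)"


section \<open>Geometric constants\<close>

text \<open>A Banach space is given by a linear subspace \<open>X\<close> of a real vector space together with a
  norm \<open>N\<close> on \<open>X\<close>. The suprema are taken in the extended reals, so that they exist without a
  boundedness proof.\<close>

definition C_NJ :: "'v::real_vector set \<Rightarrow> ('v \<Rightarrow> real) \<Rightarrow> ereal" where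
  "C_NJ X N = Sup {ereal (((N (x + y))\<^sup>2 + (N (x - y))\<^sup>2) / (2 * ((N x)\<^sup>2 + (N y)\<^sup>2))) | x y.
                   x \<in> X - {0} \<and> y \<in> X - {0}}"

definition C_J :: "'v::real_vector set \<Rightarrow> ('v \<Rightarrow> real) \<Rightarrow> ereal" where
  "C_J X N = Sup {ereal (min (N (x + y)) (N (x - y))) | x y.
                  x \<in> X \<and> y \<in> X \<and> N x = 1 \<and> N y = 1}"

definition C_DW :: "'v::real_vector set \<Rightarrow> ('v \<Rightarrow> real) \<Rightarrow> ereal" where
  "C_DW X N = Sup {ereal ((N x + N y) / N (x - y) * N (x /\<^sub>R N x - y /\<^sub>R N y)) | x y.
                   x \<in> X - {0} \<and> y \<in> X - {0} \<and> x \<noteq> y}"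

end

theory Submission
  imports Defs
begin

text \<open>The values \<open>2\<close>, \<open>2\<close>, \<open>4\<close> are the largest that the triangle inequality permits, and they are
  reached by every space that contains an isometric copy of the plane with the maximum norm.
  A small Morrey space contains such a plane for a simple reason: its norm only inspects balls of
  radius less than \<open>1\<close>. If two bumps are placed so far apart that no such ball meets both of
  them, every local term of \<open>s u + t v\<close> is a local term of \<open>s u\<close> or of \<open>t v\<close>, and the supremum of
  the terms is the larger of the two norms. With \<open>u\<close> and \<open>v\<close> normalised this gives
  \<open>\<parallel>s u + t v\<parallel> = max \<bar>s\<bar> \<bar>t\<bar>\<close>
  (\<open>small_morrey_enorm_add_separated\<close>, \<open>ball_power_integral_bumps_separated\<close>).

  In that plane \<open>(1, 1)\<close> and \<open>(1, -1)\<close> attain the von Neumann--Jordan and James constants, while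
  \<open>(1, 1)\<close> and \<open>(1 - \<epsilon>, 1 + \<epsilon>)\<close> approach the Dunkl--Williams constant as \<open>\<epsilon>\<close> tends to \<open>0\<close>
  (\<open>constants_of_plane_with_max_norm\<close>). The upper bounds rest on the Morrey norm being a seminorm,
  that is, on Minkowski's inequality over each ball (\<open>ball_power_integral_add_le\<close>).\<close>

section \<open>Geometric constants of a seminormed space\<close>

text \<open>Only the triangle inequality and homogeneity drive the upper bounds; a quotient with
  vanishing denominator is \<open>0\<close> and cannot exceed them.\<close>

locale seminormed_subspace =
  fixes X :: "'v::real_vector set" and N :: "'v \<Rightarrow> real"
  assumes subspace_X: "subspace X"
    and N_triangle: "x \<in> X \<Longrightarrow> y \<in> X \<Longrightarrow> N (x + y) \<le> N x + N y"
    and N_scaleR: "x \<in> X \<Longrightarrow> N (c *\<^sub>R x) = \<bar>c\<bar> * N x"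
begin

lemma N_zero: "N 0 = 0"
  using N_scaleR[of 0 0] subspace_0[OF subspace_X] by simp

lemma N_minus: "x \<in> X \<Longrightarrow> N (- x) = N x"
  using N_scaleR[of x "-1"] by simp

lemma N_triangle_diff: "x \<in> X \<Longrightarrow> y \<in> X \<Longrightarrow> N (x - y) \<le> N x + N y"
  using N_triangle[of x "- y"] N_minus[of y] subspace_neg[OF subspace_X, of y] by simp

lemma N_minus_commute: "x \<in> X \<Longrightarrow> y \<in> X \<Longrightarrow> N (x - y) = N (y - x)"
  using N_minus[of "x - y"] subspace_diff[OF subspace_X, of x y] by simp

lemma N_reverse_triangle: "x \<in> X \<Longrightarrow> y \<in> X \<Longrightarrow> \<bar>N x - N y\<bar> \<le> N (x - y)"
  using N_triangle[of "x - y" y] N_triangle[of "y - x" x] N_minus_commute[of x y]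
    subspace_diff[OF subspace_X, of x y] subspace_diff[OF subspace_X, of y x] by simp

lemma N_nonneg: "x \<in> X \<Longrightarrow> 0 \<le> N x"
  using N_reverse_triangle[of x 0] N_zero subspace_0[OF subspace_X] by simp

lemma C_NJ_le_2: "C_NJ X N \<le> 2"
  unfolding C_NJ_def
proof (rule Sup_least, elim CollectE exE conjE, hypsubst)
  fix x y assume "x \<in> X - {0}" "y \<in> X - {0}"
  then have xy: "x \<in> X" "y \<in> X" by simp_all
  let ?s = "(N x)\<^sup>2 + (N y)\<^sup>2"
  have mem: "x + y \<in> X" "x - y \<in> X"
    using xy subspace_X by (simp_all add: subspace_add subspace_diff)
  have "(N (x + y))\<^sup>2 \<le> (N x + N y)\<^sup>2" "(N (x - y))\<^sup>2 \<le> (N x + N y)\<^sup>2"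
    using N_triangle[OF xy] N_triangle_diff[OF xy] N_nonneg[OF mem(1)] N_nonneg[OF mem(2)]
    by (auto intro: power_mono)
  moreover have "(N x + N y)\<^sup>2 \<le> 2 * ?s"
    using zero_le_power2[of "N x - N y"] by (simp add: power2_eq_square algebra_simps)
  ultimately have "(N (x + y))\<^sup>2 + (N (x - y))\<^sup>2 \<le> 2 * (2 * ?s)"
    by simp
  then have "((N (x + y))\<^sup>2 + (N (x - y))\<^sup>2) / (2 * ?s) \<le> 2 * (2 * ?s) / (2 * ?s)"
    by (rule divide_right_mono) simp
  also have "\<dots> \<le> 2"
    by (subst times_divide_eq_right[symmetric]) (simp add: divide_self_if del: distrib_left_numeral)
  finally show "ereal (((N (x + y))\<^sup>2 + (N (x - y))\<^sup>2) / (2 * ?s)) \<le> 2"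
    by simp
qed

lemma C_J_le_2: "C_J X N \<le> 2"
  unfolding C_J_def
proof (rule Sup_least, clarify)
  fix x y assume "x \<in> X" "y \<in> X" "N x = 1" "N y = 1"
  then have "min (N (x + y)) (N (x - y)) \<le> 2"
    using N_triangle[of x y] by (simp add: min_le_iff_disj)
  then show "ereal (min (N (x + y)) (N (x - y))) \<le> 2"
    by (simp add: min_le_iff_disj)
qed

text \<open>Normalising \<open>y\<close> to the length of \<open>x\<close> moves it by \<open>\<bar>N x - N y\<bar>\<close>, which is again at most
  \<open>N (x - y)\<close>. Adding this estimate to the one with \<open>x\<close> and \<open>y\<close> exchanged bounds the
  Dunkl--Williams quotient by \<open>4\<close>.\<close>

lemma N_scaled_angle_le:
  assumes xy: "x \<in> X" "y \<in> X"
  shows "N x * N (x /\<^sub>R N x - y /\<^sub>R N y) \<le> 2 * N (x - y)"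
proof (cases "N x = 0")
  case True
  then show ?thesis
    using N_nonneg[OF subspace_diff[OF subspace_X xy]] by simp
next
  case False
  let ?z = "(1 - N x / N y) *\<^sub>R y"
  have mem: "x /\<^sub>R N x - y /\<^sub>R N y \<in> X" "x - y \<in> X" "?z \<in> X"
    using xy by (simp_all add: subspace_X subspace_diff subspace_scale)
  have "N x *\<^sub>R (x /\<^sub>R N x - y /\<^sub>R N y) = (x - y) + ?z"
    using False by (simp add: algebra_simps divide_inverse)
  then have "N x * N (x /\<^sub>R N x - y /\<^sub>R N y) \<le> N (x - y) + N ?z"
    using N_scaleR[OF mem(1), of "N x"] N_nonneg[OF xy(1)] N_triangle[OF mem(2,3)] by simp
  also have "N ?z \<le> \<bar>N x - N y\<bar>"
    using N_scaleR[OF xy(2)] N_nonneg[OF xy(2)]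
    by (cases "N y = 0") (simp_all add: field_simps abs_mult abs_divide)
  also have "\<dots> \<le> N (x - y)"
    by (rule N_reverse_triangle[OF xy])
  finally show ?thesis by simp
qed

lemma C_DW_le_4: "C_DW X N \<le> 4"
  unfolding C_DW_def
proof (rule Sup_least, elim CollectE exE conjE, hypsubst)
  fix x y assume "x \<in> X - {0}" "y \<in> X - {0}"
  then have xy: "x \<in> X" "y \<in> X" by simp_all
  let ?d = "N (x - y)" and ?u = "x /\<^sub>R N x" and ?v = "y /\<^sub>R N y"
  have "?u \<in> X" "?v \<in> X"
    using xy by (simp_all add: subspace_X subspace_scale)
  then have "N y * N (?u - ?v) \<le> 2 * ?d"
    using N_scaled_angle_le[OF xy(2,1)] N_minus_commute[OF xy] N_minus_commute[of ?u ?v] by simp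
  then have "(N x + N y) * N (?u - ?v) \<le> 4 * ?d"
    using N_scaled_angle_le[OF xy] by (simp add: distrib_right)
  moreover have "0 \<le> ?d"
    using xy by (simp add: N_nonneg subspace_X subspace_diff)
  ultimately have "(N x + N y) / ?d * N (?u - ?v) \<le> 4"
    by (cases "?d = 0") (simp_all add: field_simps)
  then show "ereal ((N x + N y) / ?d * N (?u - ?v)) \<le> 4"
    by simp
qed

text \<open>The unit ball of the plane is a square. Its adjacent corners \<open>(1, 1)\<close> and \<open>(1, -1)\<close> have sum and
  difference of norm \<open>2\<close>. For the Dunkl--Williams constant, two nearby vectors are needed whose
  distance doubles when both are put on the unit sphere: starting at the corner \<open>(1, 1)\<close>,
  the step \<open>(-\<epsilon>, \<epsilon>)\<close> leaves the square through its top edge, and normalising spends the growth of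
  the second coordinate on a further decrease of the first.\<close>

theorem constants_of_plane_with_max_norm:
  assumes uv: "u \<in> X" "v \<in> X"
    and max_norm: "\<And>a b. N (a *\<^sub>R u + b *\<^sub>R v) = max \<bar>a\<bar> \<bar>b\<bar>"
  shows "C_NJ X N = 2" "C_J X N = 2" "C_DW X N = 4"
proof -
  define P where "P a b = a *\<^sub>R u + b *\<^sub>R v" for a b
  have mem: "P a b \<in> X" for a b
    unfolding P_def using uv by (simp add: subspace_X subspace_add subspace_scale)
  have N_P: "N (P a b) = max \<bar>a\<bar> \<bar>b\<bar>" for a b
    unfolding P_def by (rule max_norm)
  have P_arith: "P a b + P c d = P (a + c) (b + d)" "P a b - P c d = P (a - c) (b - d)"
    "r *\<^sub>R P a b = P (r * a) (r * b)" for a b c d r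
    by (simp_all add: P_def algebra_simps)
  have nonzero: "P a b \<noteq> 0" if "a \<noteq> 0" for a b
    using N_P[of a b] N_zero that by auto
  have "ereal (((N (P 1 1 + P 1 (-1)))\<^sup>2 + (N (P 1 1 - P 1 (-1)))\<^sup>2) /
      (2 * ((N (P 1 1))\<^sup>2 + (N (P 1 (-1)))\<^sup>2))) \<le> C_NJ X N"
    unfolding C_NJ_def
    by (intro Sup_upper CollectI exI[of _ "P 1 1"] exI[of _ "P 1 (-1)"]) (simp add: mem nonzero)
  then have "2 \<le> C_NJ X N"
    by (simp add: P_arith N_P)
  with C_NJ_le_2 show "C_NJ X N = 2"
    by (rule antisym)
  have "ereal (min (N (P 1 1 + P 1 (-1))) (N (P 1 1 - P 1 (-1)))) \<le> C_J X N"
    unfolding C_J_def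
    by (intro Sup_upper CollectI exI[of _ "P 1 1"] exI[of _ "P 1 (-1)"]) (simp add: mem N_P)
  then have "2 \<le> C_J X N"
    by (simp add: P_arith N_P)
  with C_J_le_2 show "C_J X N = 2"
    by (rule antisym)
  have DW: "ereal (2 * (2 + e) / (1 + e)) \<le> C_DW X N" if e: "0 < e" "e < 1" for e
  proof -
    let ?x = "P 1 1" and ?y = "P (1 - e) (1 + e)"
    have N_xy: "N ?x = 1" "N ?y = 1 + e" "N (?x - ?y) = e"
      using e by (simp_all add: P_arith N_P)
    have "?x \<noteq> ?y"
      using N_xy(3) N_zero e by (metis diff_self less_irrefl)
    then have "ereal ((N ?x + N ?y) / N (?x - ?y) * N (?x /\<^sub>R N ?x - ?y /\<^sub>R N ?y)) \<le> C_DW X N"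
      unfolding C_DW_def using mem nonzero e
      by (intro Sup_upper CollectI exI[of _ ?x] exI[of _ ?y] conjI refl) simp_all
    moreover have "N (?x /\<^sub>R N ?x - ?y /\<^sub>R N ?y) = 2 * e / (1 + e)"
    proof -
      have "1 - inverse (1 + e) * (1 - e) = 2 * e / (1 + e)" "1 - inverse (1 + e) * (1 + e) = 0"
        using e by (simp_all add: field_simps)
      then show ?thesis
        unfolding N_xy P_arith N_P using e by simp
    qed
    moreover have "(1 + (1 + e)) / e * (2 * e / (1 + e)) = 2 * (2 + e) / (1 + e)"
      unfolding times_divide_times_eq
      using e by (subst frac_eq_eq) (simp_all add: mult_pos_pos less_imp_neq[symmetric], simp add: algebra_simps)
    ultimately show ?thesis
      by (simp only: N_xy)
  qed
  have "((\<lambda>e::real. 2 * (2 + e) / (1 + e)) \<longlongrightarrow> 4) (at_right 0)"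
    by (rule tendsto_eq_intros refl | simp)+
  from tendsto_ereal[OF this]
  have "((\<lambda>e. ereal (2 * (2 + e) / (1 + e))) \<longlongrightarrow> ereal 4) (at_right 0)" .
  moreover have "\<forall>\<^sub>F e in at_right 0. ereal (2 * (2 + e) / (1 + e)) \<le> C_DW X N"
    unfolding eventually_at_right_field using DW by (intro exI[of _ 1]) auto
  ultimately have "ereal 4 \<le> C_DW X N"
    by (rule tendsto_upperbound) simp
  then have "4 \<le> C_DW X N"
    by simp
  with C_DW_le_4 show "C_DW X N = 4"
    by (rule antisym)
qed

end


section \<open>The small Morrey norm as a seminorm\<close>

text \<open>The local integral as a function on equivalence classes: once it is lifted, the lemmas on the
  norm need no representatives.\<close>

lift_definition ball_power_integral :: "real \<Rightarrow>
    ('a::euclidean_space, 'b::{real_normed_vector, second_countable_topology}) ae_fun \<Rightarrow>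
    'a \<Rightarrow> real \<Rightarrow> ennreal"
  is "\<lambda>p f a R. \<integral>\<^sup>+ y \<in> ball a R. ennreal (norm (f y) powr p) \<partial>lebesgue"
proof (intro ext)
  fix p R :: real and a :: 'a and f g :: "'a \<Rightarrow> 'b"
  assume "f \<in> borel_measurable lebesgue \<and> g \<in> borel_measurable lebesgue
          \<and> (AE x in lebesgue. f x = g x)"
  then show "(\<integral>\<^sup>+ y \<in> ball a R. ennreal (norm (f y) powr p) \<partial>lebesgue) =
        (\<integral>\<^sup>+ y \<in> ball a R. ennreal (norm (g y) powr p) \<partial>lebesgue)"
    by (intro nn_integral_cong_AE) (auto elim!: eventually_mono)
qed

lemma small_morrey_enorm_eq_SUP:
  "small_morrey_enorm p q f = (SUP (a, R) \<in> UNIV \<times> {0<..<1}.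
     ennreal (measure lebesgue (ball a R) powr (1 / q - 1 / p)) *
     ennreal_powr (ball_power_integral p f a R) (1 / p))"
  by transfer simp

lemma sets_lebesgue_ball [measurable]: "ball a R \<in> sets lebesgue"
  by simp

lemma measure_lebesgue_ball_pos: "0 < R \<Longrightarrow> 0 < measure lebesgue (ball (a::'a::euclidean_space) R)"
  using content_ball_pos[of R a] by simp

lemma ennreal_powr_le_iff:
  assumes "0 < w" "0 < p" "0 \<le> c"
  shows "ennreal w * ennreal_powr t (1 / p) \<le> ennreal c \<longleftrightarrow> t \<le> ennreal ((c / w) powr p)"
proof (cases t)
  case (real r)
  have "ennreal w * ennreal_powr t (1 / p) \<le> ennreal c \<longleftrightarrow> r powr (1 / p) \<le> c / w"
    using assms real by (simp add: ennreal_powr_def ennreal_mult[symmetric] field_simps)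
  also have "\<dots> \<longleftrightarrow> r \<le> (c / w) powr p"
  proof
    assume "r powr (1 / p) \<le> c / w"
    from powr_mono2[OF _ _ this, of p] show "r \<le> (c / w) powr p"
      using assms real by (simp add: powr_powr)
  next
    assume "r \<le> (c / w) powr p"
    from powr_mono2[OF _ _ this, of "1 / p"] show "r powr (1 / p) \<le> c / w"
      using assms real by (simp add: powr_powr)
  qed
  finally show ?thesis
    using real by simp
next
  case top
  then show ?thesis
    using assms by (simp add: ennreal_powr_def ennreal_mult_top top_unique)
qed

text \<open>Clearing the weight and the root turns a bound on the norm into bounds on integrals of
  \<open>p\<close>-th powers, where infinite values need no separate treatment.\<close>

lemma small_morrey_enorm_le_iff:
  assumes "0 < p" "0 \<le> c"
  shows "small_morrey_enorm p q f \<le> ennreal c \<longleftrightarrow>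
    (\<forall>a. \<forall>R\<in>{0<..<1}. ball_power_integral p f a R \<le>
      ennreal ((c / measure lebesgue (ball a R) powr (1 / q - 1 / p)) powr p))"
  using measure_lebesgue_ball_pos
  by (auto simp: small_morrey_enorm_eq_SUP SUP_le_iff ennreal_powr_le_iff assms)

lemma small_morrey_enorm_mono:
  assumes "0 < p" "\<And>a R. R \<in> {0<..<1} \<Longrightarrow> ball_power_integral p f a R \<le> ball_power_integral p g a R"
  shows "small_morrey_enorm p q f \<le> small_morrey_enorm p q g"
proof (cases "small_morrey_enorm p q g")
  case (real c)
  then have "small_morrey_enorm p q f \<le> ennreal c"
    using small_morrey_enorm_le_iff[OF assms(1) real(1), of q g] assms
    by (auto simp: small_morrey_enorm_le_iff intro!: order_trans[OF assms(2)])
  then show ?thesis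
    using real by simp
qed simp

text \<open>The point \<open>0\<close> has to be included because the functions integrated below may vanish; there
  convexity reduces to \<open>t powr p \<le> t\<close> for \<open>t\<close> in the unit interval.\<close>

lemma convex_on_powr_nonneg:
  fixes p :: real
  assumes "1 \<le> p"
  shows "convex_on {0..} (\<lambda>x. x powr p)"
proof (rule convex_on_linorderI)
  fix t x y :: real
  assume t: "0 < t" "t < 1" and xy: "x \<in> {0..}" "y \<in> {0..}" "x < y"
  show "((1 - t) *\<^sub>R x + t *\<^sub>R y) powr p \<le> (1 - t) * x powr p + t * y powr p"
  proof (cases "x = 0")
    case True
    have "t powr p \<le> t powr 1"
      using assms t by (intro powr_mono') auto
    then show ?thesis
      using True t xy by (simp add: powr_mult mult_right_mono)
  next
    case False
    then show ?thesis
      using convex_onD[OF powr_convex[OF assms], of t x y] t xy by simp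
  qed
qed simp

text \<open>This is convexity of the power at \<open>s / A\<close> and \<open>t / B\<close> with weights proportional to \<open>A\<close> and \<open>B\<close>.
  With \<open>A\<close>, \<open>B\<close> bounding the \<open>L\<^sup>p\<close> norms of \<open>f\<close>, \<open>g\<close> and \<open>s\<close>, \<open>t\<close> their pointwise norms, each power
  on the right integrates to at most \<open>1\<close>, hence Minkowski's inequality below.\<close>

lemma powr_add_le_convex_combination:
  fixes p s t A B :: real
  assumes "1 \<le> p" "0 < A" "0 < B" "0 \<le> s" "0 \<le> t"
  shows "(s + t) powr p \<le> (A + B) powr p *
    (A / (A + B) * (s / A) powr p + B / (A + B) * (t / B) powr p)"
proof -
  have "1 - B / (A + B) = A / (A + B)"
    using assms by (simp add: field_simps)
  moreover have "A / (A + B) * (s / A) + B / (A + B) * (t / B) = (s + t) / (A + B)"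
    using assms by (simp add: add_divide_distrib)
  ultimately have "((s + t) / (A + B)) powr p \<le>
      A / (A + B) * (s / A) powr p + B / (A + B) * (t / B) powr p"
    using convex_onD[OF convex_on_powr_nonneg[OF assms(1)], of "B / (A + B)" "s / A" "t / B"] assms
    by simp
  then show ?thesis
    using assms by (simp add: powr_divide divide_le_eq mult.commute)
qed

text \<open>Minkowski's inequality on a ball, phrased with positive upper bounds \<open>A\<close>, \<open>B\<close> of the two norms so
  that dividing by them is always possible.\<close>

lemma ball_power_integral_add_le:
  assumes "1 \<le> p" "0 < A" "0 < B"
    and "ball_power_integral p f a R \<le> ennreal (A powr p)"
    and "ball_power_integral p g a R \<le> ennreal (B powr p)"
  shows "ball_power_integral p (f + g) a R \<le> ennreal ((A + B) powr p)"
  using assms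
proof (transfer fixing: p A B a R, elim conjE)
  fix f g :: "'a \<Rightarrow> 'b"
  note pAB = assms(1-3)
  let ?I = "\<lambda>f. \<integral>\<^sup>+ y \<in> ball a R. ennreal (norm (f y) powr p) \<partial>lebesgue"
  assume [measurable]: "f \<in> borel_measurable lebesgue" "g \<in> borel_measurable lebesgue"
  assume f: "?I f \<le> ennreal (A powr p)" and g: "?I g \<le> ennreal (B powr p)"
  let ?s = "A / (A + B) / A powr p" and ?t = "B / (A + B) / B powr p"
  have "?I (\<lambda>x. f x + g x) \<le> (\<integral>\<^sup>+ y. ennreal ((A + B) powr p) *
      (ennreal ?s * (ennreal (norm (f y) powr p) * indicator (ball a R) y)
       + ennreal ?t * (ennreal (norm (g y) powr p) * indicator (ball a R) y)) \<partial>lebesgue)"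
  proof (rule nn_integral_mono)
    fix y
    have "norm (f y + g y) powr p \<le> (norm (f y) + norm (g y)) powr p"
      using pAB by (intro powr_mono2 norm_triangle_ineq) auto
    also have "\<dots> \<le> (A + B) powr p * (?s * norm (f y) powr p + ?t * norm (g y) powr p)"
      using powr_add_le_convex_combination[OF pAB, of "norm (f y)" "norm (g y)"] pAB
      by (simp add: powr_divide)
    finally show "ennreal (norm (f y + g y) powr p) * indicator (ball a R) y \<le>
      ennreal ((A + B) powr p) *
      (ennreal ?s * (ennreal (norm (f y) powr p) * indicator (ball a R) y)
       + ennreal ?t * (ennreal (norm (g y) powr p) * indicator (ball a R) y))"
      using pAB by (auto simp: indicator_def ennreal_mult[symmetric] ennreal_plus[symmetric]
          simp del: ennreal_plus)
  qed
  also have "\<dots> = ennreal ((A + B) powr p) * (ennreal ?s * ?I f + ennreal ?t * ?I g)"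
    by (simp add: nn_integral_cmult nn_integral_add)
  also have "\<dots> \<le> ennreal ((A + B) powr p) *
      (ennreal ?s * ennreal (A powr p) + ennreal ?t * ennreal (B powr p))"
    by (intro mult_left_mono add_mono f g) auto
  also have "\<dots> = ennreal ((A + B) powr p)"
    using pAB by (simp add: ennreal_mult[symmetric] ennreal_plus[symmetric] add_divide_distrib[symmetric]
        del: ennreal_plus)
  finally show "?I (\<lambda>x. f x + g x) \<le> ennreal ((A + B) powr p)" .
qed

lemma ball_power_integral_scaleR:
  "ball_power_integral p (c *\<^sub>R f) a R = ennreal (\<bar>c\<bar> powr p) * ball_power_integral p f a R"
proof (transfer fixing: p c a R)
  fix f :: "'a \<Rightarrow> 'b"
  assume "f \<in> borel_measurable lebesgue \<and> f \<in> borel_measurable lebesgue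
          \<and> (AE x in lebesgue. f x = f x)"
  then have [measurable]: "f \<in> borel_measurable lebesgue" by simp
  show "(\<integral>\<^sup>+ y \<in> ball a R. ennreal (norm (c *\<^sub>R f y) powr p) \<partial>lebesgue) =
    ennreal (\<bar>c\<bar> powr p) * (\<integral>\<^sup>+ y \<in> ball a R. ennreal (norm (f y) powr p) \<partial>lebesgue)"
    by (subst nn_integral_cmult[symmetric])
      (auto simp: powr_mult ennreal_mult mult.assoc intro!: nn_integral_cong)
qed

lemma small_morrey_enorm_triangle:
  fixes f g :: "('a::euclidean_space, 'b::{real_normed_vector, second_countable_topology}) ae_fun"
  assumes p: "1 \<le> p"
  shows "small_morrey_enorm p q (f + g) \<le> small_morrey_enorm p q f + small_morrey_enorm p q g"
proof (cases "small_morrey_enorm p q f = \<infinity> \<or> small_morrey_enorm p q g = \<infinity>")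
  case False
  then obtain A B where A: "0 \<le> A" "small_morrey_enorm p q f = ennreal A"
    and B: "0 \<le> B" "small_morrey_enorm p q g = ennreal B"
    by (metis ennreal_cases infinity_ennreal_def)
  have bound: "small_morrey_enorm p q (f + g) \<le> ennreal (A + B) + ennreal e" if e: "0 < e" for e
  proof -
    \<comment> \<open>The enlargement by \<open>e / 2\<close> makes both bounds positive even when a norm vanishes.\<close>
    let ?A = "A + e / 2" and ?B = "B + e / 2"
    let ?w = "\<lambda>a::'a. \<lambda>R. measure lebesgue (ball a R) powr (1 / q - 1 / p)"
    have "small_morrey_enorm p q f \<le> ennreal ?A" "small_morrey_enorm p q g \<le> ennreal ?B"
      using A B e by (auto intro!: ennreal_leI)
    moreover have "0 \<le> ?A" "0 \<le> ?B" "0 < p"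
      using A B e p by simp_all
    ultimately have f: "ball_power_integral p f a R \<le> ennreal ((?A / ?w a R) powr p)"
      and g: "ball_power_integral p g a R \<le> ennreal ((?B / ?w a R) powr p)"
      if "R \<in> {0<..<1}" for a R
      using small_morrey_enorm_le_iff[of p ?A q f] small_morrey_enorm_le_iff[of p ?B q g] that
      by blast+
    have "ball_power_integral p (f + g) a R \<le> ennreal (((?A + ?B) / ?w a R) powr p)"
      if R: "R \<in> {0<..<1}" for a R
    proof -
      have "0 < ?w a R"
        using R measure_lebesgue_ball_pos[of R a] by simp
      then show ?thesis
        unfolding add_divide_distrib[of ?A ?B]
        using A B e by (intro ball_power_integral_add_le[OF p _ _ f[OF R] g[OF R]]) simp_all
    qed
    then have "small_morrey_enorm p q (f + g) \<le> ennreal (?A + ?B)"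
      using A B e p by (subst small_morrey_enorm_le_iff) auto
    also have "?A + ?B = (A + B) + e" by simp
    finally show ?thesis
      using A B e by simp
  qed
  have "small_morrey_enorm p q (f + g) \<le> ennreal (A + B)"
    by (rule ennreal_le_epsilon) (rule bound)
  then show ?thesis
    using A B by simp
qed auto

lemma small_morrey_enorm_scaleR_le:
  fixes f :: "('a::euclidean_space, 'b::{real_normed_vector, second_countable_topology}) ae_fun"
  assumes p: "0 < p"
  shows "small_morrey_enorm p q (c *\<^sub>R f) \<le> ennreal \<bar>c\<bar> * small_morrey_enorm p q f"
proof (cases "small_morrey_enorm p q f")
  case (real A)
  have "small_morrey_enorm p q (c *\<^sub>R f) \<le> ennreal (\<bar>c\<bar> * A)"
    unfolding small_morrey_enorm_le_iff[OF p mult_nonneg_nonneg[OF abs_ge_zero real(1)]]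
  proof (intro allI ballI)
    fix a :: 'a and R :: real assume R: "R \<in> {0<..<1}"
    let ?w = "measure lebesgue (ball a R) powr (1 / q - 1 / p)"
    have "ball_power_integral p f a R \<le> ennreal ((A / ?w) powr p)"
      using small_morrey_enorm_le_iff[OF p real(1), of q f] real R by simp
    then have "ball_power_integral p (c *\<^sub>R f) a R \<le> ennreal (\<bar>c\<bar> powr p) * ennreal ((A / ?w) powr p)"
      unfolding ball_power_integral_scaleR by (rule mult_left_mono) simp
    also have "\<dots> = ennreal ((\<bar>c\<bar> * A / ?w) powr p)"
      using real by (simp add: ennreal_mult[symmetric] powr_mult[symmetric])
    finally show "ball_power_integral p (c *\<^sub>R f) a R \<le> ennreal ((\<bar>c\<bar> * A / ?w) powr p)" .
  qed
  then show ?thesis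
    using real by (simp add: ennreal_mult)
next
  case top
  show ?thesis
  proof (cases "c = 0")
    case True
    have "small_morrey_enorm p q (c *\<^sub>R f) \<le> ennreal 0"
      using p True by (subst small_morrey_enorm_le_iff) (simp_all add: ball_power_integral_scaleR del: scaleR_zero_left)
    then show ?thesis by simp
  next
    case False
    then show ?thesis
      using top by (simp add: ennreal_mult_top)
  qed
qed

text \<open>The converse inequality is the previous one for the inverse scalar.\<close>

lemma small_morrey_enorm_scaleR:
  assumes p: "0 < p"
  shows "small_morrey_enorm p q (c *\<^sub>R f) = ennreal \<bar>c\<bar> * small_morrey_enorm p q f"
proof (cases "c = 0")
  case True
  then show ?thesis
    using small_morrey_enorm_scaleR_le[OF p, of q 0 f] by simp
next
  case False
  have "ennreal \<bar>c\<bar> * small_morrey_enorm p q f \<le>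
      ennreal \<bar>c\<bar> * (ennreal \<bar>inverse c\<bar> * small_morrey_enorm p q (c *\<^sub>R f))"
    using small_morrey_enorm_scaleR_le[OF p, of q "inverse c" "c *\<^sub>R f"] False
    by (intro mult_left_mono) simp_all
  also have "\<dots> = small_morrey_enorm p q (c *\<^sub>R f)"
    using False by (simp add: mult.assoc[symmetric] ennreal_mult[symmetric] abs_mult[symmetric])
  finally show ?thesis
    using small_morrey_enorm_scaleR_le[OF p] by (intro antisym)
qed

lemma seminormed_subspace_small_morrey:
  fixes p q :: real
  assumes p: "1 \<le> p"
  shows "seminormed_subspace (small_morrey p q ::
    ('a::euclidean_space, 'b::{real_normed_vector, second_countable_topology}) ae_fun set)
    (small_morrey_norm p q)"
proof
  let ?X = "small_morrey p q :: ('a, 'b) ae_fun set"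
  have scaleR: "small_morrey_enorm p q (c *\<^sub>R f) = ennreal \<bar>c\<bar> * small_morrey_enorm p q f"
    for c and f :: "('a, 'b) ae_fun"
    using p by (intro small_morrey_enorm_scaleR) simp
  show "subspace ?X"
    unfolding subspace_def small_morrey_def
  proof (safe, goal_cases)
    case 1 show ?case
      using scaleR[of 0 0] by simp
  next
    case (2 f g) then show ?case
      by (intro le_less_trans[OF small_morrey_enorm_triangle[OF p]]) simp
  next
    case (3 c f) then show ?case
      by (simp add: scaleR ennreal_mult_less_top)
  qed
  fix f g :: "('a, 'b) ae_fun"
  assume "f \<in> ?X"
  then have f: "small_morrey_enorm p q f < top"
    by (simp add: small_morrey_def)
  show "small_morrey_norm p q (c *\<^sub>R f) = \<bar>c\<bar> * small_morrey_norm p q f" for c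
    by (simp add: small_morrey_norm_def scaleR enn2real_mult)
  assume "g \<in> ?X"
  then have g: "small_morrey_enorm p q g < top"
    by (simp add: small_morrey_def)
  show "small_morrey_norm p q (f + g) \<le> small_morrey_norm p q f + small_morrey_norm p q g"
    unfolding small_morrey_norm_def enn2real_plus[OF f g, symmetric]
    using f g by (intro enn2real_mono small_morrey_enorm_triangle p) simp
qed


section \<open>Functions that no small ball sees together\<close>

lemma ball_power_integral_add_null:
  assumes "ball_power_integral p g a R = 0"
  shows "ball_power_integral p (f + g) a R = ball_power_integral p f a R"
  using assms
proof (transfer fixing: p a R, elim conjE)
  fix f g :: "'a \<Rightarrow> 'b"
  let ?I = "\<lambda>f. \<integral>\<^sup>+ y \<in> ball a R. ennreal (norm (f y) powr p) \<partial>lebesgue"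
  assume [measurable]: "f \<in> borel_measurable lebesgue" "g \<in> borel_measurable lebesgue"
  assume "?I g = 0"
  then have "AE y in lebesgue. ennreal (norm (g y) powr p) * indicator (ball a R) y = 0"
    by (subst (asm) nn_integral_0_iff_AE) auto
  then show "?I (\<lambda>x. f x + g x) = ?I f"
    by (intro nn_integral_cong_AE) (auto elim!: eventually_mono simp: indicator_def)
qed

text \<open>On each ball one summand vanishes almost everywhere, so the local integral of the sum is the
  maximum of the two local integrals; a supremum of maxima is the maximum of the suprema.\<close>

lemma small_morrey_enorm_add_separated:
  assumes p: "0 < p"
    and separated: "\<And>a R. R \<in> {0<..<1} \<Longrightarrow>
      ball_power_integral p f a R = 0 \<or> ball_power_integral p g a R = 0"
  shows "small_morrey_enorm p q (f + g) = max (small_morrey_enorm p q f) (small_morrey_enorm p q g)"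
    (is "?fg = max ?f ?g")
proof (rule antisym)
  have sum: "ball_power_integral p (f + g) a R =
      max (ball_power_integral p f a R) (ball_power_integral p g a R)" if "R \<in> {0<..<1}" for a R
    using separated[OF that, of a] ball_power_integral_add_null[of p g a R f]
      ball_power_integral_add_null[of p f a R g] by (auto simp: add.commute)
  show "max ?f ?g \<le> ?fg"
    using p sum by (auto intro!: small_morrey_enorm_mono)
  show "?fg \<le> max ?f ?g"
  proof (cases "max ?f ?g")
    case (real c)
    then have "?f \<le> ennreal c" "?g \<le> ennreal c"
      by (metis max.cobounded1, metis max.cobounded2)
    then have "?fg \<le> ennreal c"
      using p real sum by (simp add: small_morrey_enorm_le_iff)
    then show ?thesis
      using real by simp
  qed simp
qed

lift_definition bump :: "'a \<Rightarrow> 'b \<Rightarrow>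
    ('a::euclidean_space, 'b::{real_normed_vector, second_countable_topology}) ae_fun"
  is "\<lambda>c e x. indicator (ball c (1 / 2)) x *\<^sub>R e"
  by simp

lemma ball_power_integral_bump:
  assumes "0 < p"
  shows "ball_power_integral p (bump c e) a R =
    ennreal (norm e powr p) * emeasure lebesgue (ball c (1 / 2) \<inter> ball a R)"
proof (transfer fixing: p c e a R)
  show "(\<integral>\<^sup>+ y \<in> ball a R. ennreal (norm (indicator (ball c (1 / 2)) y *\<^sub>R e) powr p) \<partial>lebesgue) =
      ennreal (norm e powr p) * emeasure lebesgue (ball c (1 / 2) \<inter> ball a R)"
    using assms
    by (subst nn_integral_cmult_indicator[symmetric])
      (auto intro!: nn_integral_cong simp: indicator_def)
qed

text \<open>A ball of radius less than \<open>1\<close> has diameter less than \<open>2\<close>, and the two bumps extend \<open>1 / 2\<close> from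
  their centres, so a ball meeting both would put the centres at distance less than \<open>3\<close>.\<close>

lemma ball_power_integral_bumps_separated:
  assumes "0 < p" "3 \<le> dist c c'" "R < 1"
  shows "ball_power_integral p (bump c e) a R = 0 \<or> ball_power_integral p (bump c' e') a R = 0"
proof -
  have "ball c (1 / 2) \<inter> ball a R = {} \<or> ball c' (1 / 2) \<inter> ball a R = {}"
  proof (rule ccontr)
    assume "\<not> ?thesis"
    then obtain x y where "dist c x < 1 / 2" "dist a x < R" "dist c' y < 1 / 2" "dist a y < R"
      by auto
    then show False
      using assms dist_triangle[of c c' x] dist_triangle[of x c' a] dist_triangle[of a c' y]
      by (simp add: dist_commute)
  qed
  then show ?thesis
    using assms by (auto simp: ball_power_integral_bump)
qed

text \<open>For a bounded function the local term on a ball of volume \<open>V\<close> is at most a multiple of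
  \<open>V powr (1 / q - 1 / p) * V powr (1 / p) = V powr (1 / q)\<close>, and \<open>V\<close> is at most the volume of the unit
  ball.\<close>

lemma bump_in_small_morrey:
  fixes c :: "'a::euclidean_space"
  assumes "0 < p" "0 < q"
  shows "bump c e \<in> small_morrey p q"
proof -
  let ?V = "\<lambda>a::'a. \<lambda>R. measure lebesgue (ball a R)"
  let ?C = "norm e * ?V 0 1 powr (1 / q)"
  have "\<forall>a. \<forall>R\<in>{0<..<1}. ball_power_integral p (bump c e) a R \<le>
      ennreal ((?C / ?V a R powr (1 / q - 1 / p)) powr p)"
  proof (intro allI ballI)
    fix a :: 'a and R :: real assume R: "R \<in> {0<..<1}"
    then have pos: "0 < ?V a R"
      by (simp add: measure_lebesgue_ball_pos)
    have V_le: "?V a R \<le> ?V 0 1"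
      using R content_ball_pos[of 1 "0::'a"] by (simp add: content_ball power_le_one)
    have "ball_power_integral p (bump c e) a R \<le> ennreal (norm e powr p) * emeasure lebesgue (ball a R)"
      unfolding ball_power_integral_bump[OF assms(1)] by (intro mult_left_mono emeasure_mono) auto
    also have "\<dots> = ennreal (norm e powr p * ?V a R)"
      using emeasure_lborel_ball_finite[of a R] by (simp add: ennreal_mult emeasure_eq_ennreal_measure)
    also have "norm e powr p * ?V a R = (norm e * (?V a R powr (1 / q)) / ?V a R powr (1 / q - 1 / p)) powr p"
      using assms pos by (simp add: powr_mult powr_powr powr_diff)
    also have "\<dots> \<le> (?C / ?V a R powr (1 / q - 1 / p)) powr p"
      using assms V_le by (intro powr_mono2 divide_right_mono mult_left_mono) auto
    finally show "ball_power_integral p (bump c e) a R \<le> ennreal ((?C / ?V a R powr (1 / q - 1 / p)) powr p)"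
      by (simp add: ennreal_leI)
  qed
  moreover have "0 \<le> ?C"
    by simp
  ultimately have "small_morrey_enorm p q (bump c e) \<le> ennreal ?C"
    using small_morrey_enorm_le_iff[OF assms(1), of ?C q "bump c e"] by blast
  then show ?thesis
    unfolding small_morrey_def mem_Collect_eq infinity_ennreal_def
    by (rule le_less_trans[OF _ ennreal_less_top])
qed

lemma small_morrey_norm_bump_pos:
  assumes "0 < p" "0 < q" "e \<noteq> 0"
  shows "0 < small_morrey_norm p q (bump c e)"
proof (rule ccontr)
  assume "\<not> ?thesis"
  then have "small_morrey_enorm p q (bump c e) \<le> ennreal 0"
    using bump_in_small_morrey[OF assms(1,2), of c e]
    by (auto simp: small_morrey_norm_def small_morrey_def enn2real_positive_iff not_gr_zero)
  then have "ball_power_integral p (bump c e) c (1 / 2) \<le> 0"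
    using small_morrey_enorm_le_iff[OF assms(1) order.refl, THEN iffD1, rule_format, of q "bump c e" "1 / 2" c]
    by simp
  then show False
    using assms emeasure_eq_ennreal_measure[of lebesgue "ball c (1 / 2)"]
      measure_lebesgue_ball_pos[of "1 / 2" c]
    by (simp add: ball_power_integral_bump)
qed

text \<open>The argument is the same for every nonzero range space; the real and the complex case are
  instances. Dividing each bump by its own norm produces the unit vectors that span the plane.\<close>

theorem geometric_constants_small_morrey:
  fixes p q :: real and e :: "'b::{real_normed_vector, second_countable_topology}"
  defines "X \<equiv> small_morrey p q :: ('a::euclidean_space, 'b) ae_fun set"
  assumes p: "1 \<le> p" and q: "0 < q" and e: "e \<noteq> 0"
  shows "C_NJ X (small_morrey_norm p q) = 2" "C_J X (small_morrey_norm p q) = 2"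
    "C_DW X (small_morrey_norm p q) = 4"
proof -
  interpret seminormed_subspace X "small_morrey_norm p q"
    unfolding X_def using p by (rule seminormed_subspace_small_morrey)
  have p0: "0 < p" using p by simp
  obtain b :: 'a where "b \<in> Basis"
    using nonempty_Basis by blast
  then have far: "3 \<le> dist 0 (3 *\<^sub>R b)"
    by (simp add: norm_Basis)
  define unit :: "'a \<Rightarrow> ('a, 'b) ae_fun"
    where "unit c = bump c e /\<^sub>R small_morrey_norm p q (bump c e)" for c
  let ?u = "unit 0" and ?v = "unit (3 *\<^sub>R b)"
  have mem: "unit c \<in> X" for c
    unfolding unit_def using bump_in_small_morrey[OF p0 q, of c e]
    by (auto simp: X_def intro: subspace_scale[OF subspace_X[unfolded X_def]])
  have norm_unit: "small_morrey_norm p q (unit c) = 1" for c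
    unfolding unit_def using bump_in_small_morrey[OF p0 q, of c e] small_morrey_norm_bump_pos[OF p0 q e, of c]
    by (subst N_scaleR) (auto simp: X_def)
  have "small_morrey_norm p q (s *\<^sub>R ?u + t *\<^sub>R ?v) = max \<bar>s\<bar> \<bar>t\<bar>" for s t
  proof -
    have "small_morrey_enorm p q (s *\<^sub>R ?u + t *\<^sub>R ?v) =
        max (small_morrey_enorm p q (s *\<^sub>R ?u)) (small_morrey_enorm p q (t *\<^sub>R ?v))"
    proof (rule small_morrey_enorm_add_separated[OF p0])
      fix a :: 'a and R :: real assume "R \<in> {0<..<1}"
      then show "ball_power_integral p (s *\<^sub>R ?u) a R = 0 \<or> ball_power_integral p (t *\<^sub>R ?v) a R = 0"
        using ball_power_integral_bumps_separated[OF p0 far, of R e a e]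
        unfolding unit_def ball_power_integral_scaleR by auto
    qed
    moreover have "small_morrey_enorm p q (r *\<^sub>R unit c) = ennreal \<bar>r\<bar>" for r c
    proof -
      have "r *\<^sub>R unit c \<in> X"
        using mem by (simp add: subspace_X subspace_scale)
      then have "small_morrey_enorm p q (r *\<^sub>R unit c) = ennreal (small_morrey_norm p q (r *\<^sub>R unit c))"
        by (simp add: X_def small_morrey_def small_morrey_norm_def)
      then show ?thesis
        using N_scaleR[OF mem] norm_unit by simp
    qed
    ultimately have "small_morrey_enorm p q (s *\<^sub>R ?u + t *\<^sub>R ?v) = ennreal (max \<bar>s\<bar> \<bar>t\<bar>)"
      by (auto simp: max_def)
    then show ?thesis
      by (simp add: small_morrey_norm_def)
  qed
  note constants = constants_of_plane_with_max_norm[OF mem mem this]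
  show "C_NJ X (small_morrey_norm p q) = 2" "C_J X (small_morrey_norm p q) = 2"
    "C_DW X (small_morrey_norm p q) = 4"
    by (fact constants)+
qed

theorem theorem2p1:
  fixes p q :: real
  assumes "1 \<le> p" and "p < q"
  shows "C_NJ (small_morrey p q :: (real ^ 'd, real) ae_fun set) (small_morrey_norm p q) = 2
       \<and> C_J (small_morrey p q :: (real ^ 'd, real) ae_fun set) (small_morrey_norm p q) = 2
       \<and> C_DW (small_morrey p q :: (real ^ 'd, real) ae_fun set) (small_morrey_norm p q) = 4
       \<and> C_NJ (small_morrey p q :: (real ^ 'd, complex) ae_fun set) (small_morrey_norm p q) = 2
       \<and> C_J (small_morrey p q :: (real ^ 'd, complex) ae_fun set) (small_morrey_norm p q) = 2
       \<and> C_DW (small_morrey p q :: (real ^ 'd, complex) ae_fun set) (small_morrey_norm p q) = 4"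
proof -
  have "0 < q" using assms by simp
  note constants = geometric_constants_small_morrey[OF assms(1) this one_neq_zero]
  show ?thesis
    by (intro conjI constants)
qed

end
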